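(* For every fixed nonzero real $\rho$, the compatibility condition $\det\mathcal M_\rho[F](t)=0$ has exactly two solution germs $F$ analytic at $t=0$ within the normalization $$F(0)=F'(0)=F''(0)=F'''(0)=0,\qquad [t^4]F=\frac{\rho}{16},$$ provided $F$ is sought in the graded analytic class, i.e. among convergent series of the form $$F(t)=\sum_{m=0}^{\infty}A_m\,\rho^{2m+1}\left(\frac t2\right)^{7m+4}.$$
   Context: $[t^4]F$ denotes the coefficient of $t^4$ in the Taylor series of $F$ at $0$. The compatibility matrix, depending on $t$ through $t$, $F=F(t)$ and the derivatives $F',F'',F'''$ of $F$ at $t$, is $$\mathcal M_\rho[F]=\begin{pmatrix} 1&\rho t^3&3\rho t^2F&3\rho t(F^2+3t)&\rho(F^3+15tF)&6\rho(F^2+2t)\\ \frac12&3F'&6(F')^2&6F''+4(F')^3&12F'F''&4F'''\\ 0&1&\rho t^3&3\rho t^2F&3\rho t(F^2+2t)&\rho(F^3+9tF)\\ 0&0&1&4F'&4(F')^2&4F''\\ 0&0&1&\rho t^3&3\rho t^2F&3\rho t(F^2+t)\\ 0&0&0&0&1&2F' \end{pmatrix}.$$ The condition $\det\mathcal M_\rho[F](t)=0$ is required for all $t$ in a neighbourhood of $0$. *)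

theory Defs
  imports "HOL-Analysis.FPS_Convergence" "Jordan_Normal_Form.Determinant"
begin

text \<open>
  Everything is polymorphic in the scalar type \<^typ>\<open>'a\<close> of class
  \<open>{real_normed_field, banach}\<close>, so that both real and complex analytic germs are covered;
  the parameter \<open>\<rho>\<close> is real and enters through \<^const>\<open>of_real\<close>.
\<close>

definition compat_matrix ::
  "real \<Rightarrow> ('a \<Rightarrow> 'a) \<Rightarrow> 'a \<Rightarrow> 'a::{real_normed_field, banach} mat" where
  "compat_matrix rho f t =
    (let \<rho> = of_real rho; F = f t;
         F1 = deriv f t; F2 = (deriv ^^ 2) f t; F3 = (deriv ^^ 3) f t
     in mat_of_rows_list 6
      [[1,   \<rho>*t^3, 3*\<rho>*t^2*F, 3*\<rho>*t*(F^2 + 3*t), \<rho>*(F^3 + 15*t*F), 6*\<rho>*(F^2 + 2*t)],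
       [1/2, 3*F1,  6*F1^2,     6*F2 + 4*F1^3,     12*F1*F2,         4*F3],
       [0,   1,     \<rho>*t^3,      3*\<rho>*t^2*F,        3*\<rho>*t*(F^2 + 2*t), \<rho>*(F^3 + 9*t*F)],
       [0,   0,     1,          4*F1,             4*F1^2,           4*F2],
       [0,   0,     1,          \<rho>*t^3,            3*\<rho>*t^2*F,       3*\<rho>*t*(F^2 + t)],
       [0,   0,     0,          0,                1,                2*F1]])"

text \<open>\<open>Determinant.det\<close> is qualified because HOL-Analysis has a \<open>det\<close> of its own.\<close>

definition compat_condition :: "real \<Rightarrow> ('a \<Rightarrow> 'a::{real_normed_field, banach}) \<Rightarrow> bool" where
  "compat_condition rho F \<longleftrightarrow>
     (\<forall>\<^sub>F t in nhds 0. Determinant.det (compat_matrix rho F t) = 0)"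

definition analytic_at_0 :: "('a \<Rightarrow> 'a::{real_normed_field, banach}) \<Rightarrow> bool" where
  "analytic_at_0 F \<longleftrightarrow> (\<exists>P. F has_fps_expansion P)"

definition taylor_coeff :: "nat \<Rightarrow> ('a \<Rightarrow> 'a::{real_normed_field, banach}) \<Rightarrow> 'a" where
  "taylor_coeff n F = (deriv ^^ n) F 0 / fact n"

definition graded_analytic :: "real \<Rightarrow> ('a \<Rightarrow> 'a::{real_normed_field, banach}) \<Rightarrow> bool" where
  "graded_analytic rho F \<longleftrightarrow>
     (\<exists>A :: nat \<Rightarrow> 'a. \<forall>\<^sub>F t in nhds 0.
        (\<lambda>m. A m * of_real rho ^ (2 * m + 1) * (t / 2) ^ (7 * m + 4)) sums F t)"

text \<open>Germs at 0 are the equivalence classes of this relation.\<close>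

definition germ_rel :: "('a \<Rightarrow> 'a::{real_normed_field, banach}) rel" where
  "germ_rel = {(F, G). \<forall>\<^sub>F t in nhds 0. F t = G t}"

end

theory Submission
  imports Defs
begin

text \<open>
  The determinant is a polynomial in \<open>\<rho>\<close>, \<open>t\<close>, \<open>F\<close> and its first three derivatives, and it is
  homogeneous for the grading behind the ansatz. Put \<open>c = \<rho> / 16\<close>, \<open>x = 2 c\<^sup>2 t\<^sup>7\<close> and
  \<open>F = c t\<^sup>4 \<phi>(x)\<close> with \<open>\<phi> = \<Sum> A m x\<^sup>m\<close>. Differentiation of \<open>F\<close> multiplies \<open>A m\<close> by the falling
  factors of \<open>7 m + 4\<close>, all powers of \<open>t\<close> collect into \<open>x\<close>, and the condition becomes
  \<open>red_poly x \<phi>\<^sub>0 \<phi>\<^sub>1 \<phi>\<^sub>2 \<phi>\<^sub>3 = 0\<close> for the series \<open>\<phi>\<^sub>k\<close> with coefficients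
  \<open>(7m+4)(7m+3)...(7m+5-k) A m\<close> (\<open>compat_poly_graded_fps\<close>).

  The normalization says \<open>A 0 = 1\<close>. This value is a double root of the lowest-order equation, so the
  linearization at it vanishes identically and the next order, \<open>x\<^sup>1\<close>, holds automatically.
  The order \<open>x\<^sup>2\<close> gives the quadratic equation \<open>484 (30 a\<^sup>2 - 11 a + 1) = 0\<close> for \<open>a = A 1\<close>, with the roots
  \<open>1/5\<close> and \<open>1/6\<close>: these are the two germs. Each coefficient \<open>A (m + 2)\<close> first occurs
  at order \<open>m + 3\<close> of \<open>x\<close>, linearly, with a factor \<open>indicial a m\<close> that is cubic in \<open>n = 7 m + 18\<close>
  (\<open>red_poly_euler_eq_0_iff\<close>). For the two roots the factor is \<open>-22/5 n (n - 1) (n - 12)\<close> and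
  \<open>-11/3 n (n - 10) (n + 1)\<close>, which never vanishes because \<open>n \<ge> 18\<close>. Hence \<open>A\<close> is determined by \<open>A 1\<close>.

  Convergence is a majorant argument. The factor grows like \<open>n\<^sup>3\<close>, as fast as the largest factor that
  three differentiations produce, so the series \<open>h\<^sub>k\<close> of all derivatives, of order up to 3, of the unknown
  part are bounded together. Truncated weighted \<open>\<ell>\<^sup>1\<close> norms turn the recursion into
  \<open>S (M + 1) \<le> C (B + R D)\<close> whenever \<open>S M \<le> s\<close>, where \<open>B\<close> does not depend on \<open>s\<close>; with \<open>s = C (B + 1)\<close> and
  a small radius \<open>R\<close> the bound \<open>s\<close> is preserved (\<open>solution_bounded\<close>).
\<close>

section \<open>The determinant as a polynomial\<close>

lemma det_rows_expand_first_column: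
  fixes rs :: "'a::comm_ring_1 list list"
  assumes "length rs = Suc n" "\<forall>r\<in>set rs. length r = Suc n"
  shows "Determinant.det (mat_of_rows_list (Suc n) rs) =
    (\<Sum>i<Suc n. rs ! i ! 0 * ((-1) ^ i *
       Determinant.det (mat_of_rows_list n (map tl (take i rs @ drop (Suc i) rs)))))"
proof -
  let ?A = "mat_of_rows_list (Suc n) rs"
  have "mat_delete ?A i 0 = mat_of_rows_list n (map tl (take i rs @ drop (Suc i) rs))"
    if "i < Suc n" for i
  proof (rule eq_matI)
    show "dim_row (mat_delete ?A i 0) = dim_row (mat_of_rows_list n (map tl (take i rs @ drop (Suc i) rs)))"
      using assms that by (simp add: mat_delete_def mat_of_rows_list_def)
    show "dim_col (mat_delete ?A i 0) = dim_col (mat_of_rows_list n (map tl (take i rs @ drop (Suc i) rs)))"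
      using assms that by (simp add: mat_delete_def mat_of_rows_list_def)
    fix k l
    assume "k < dim_row (mat_of_rows_list n (map tl (take i rs @ drop (Suc i) rs)))"
      and "l < dim_col (mat_of_rows_list n (map tl (take i rs @ drop (Suc i) rs)))"
    then have kl: "k < n" "l < n"
      using assms that by (auto simp: mat_of_rows_list_def)
    have "length (rs ! j) = Suc n" if "j < Suc n" for j
      using assms that by simp
    then show "mat_delete ?A i 0 $$ (k, l) =
        mat_of_rows_list n (map tl (take i rs @ drop (Suc i) rs)) $$ (k, l)"
      using assms that kl
      by (auto simp: mat_delete_def mat_of_rows_list_def nth_append nth_tl min_def)
  qed
  moreover have "?A \<in> carrier_mat (Suc n) (Suc n)"
    using assms by (simp add: mat_of_rows_list_def)
  ultimately show ?thesis
    using assms by (subst laplace_expansion_column[of _ "Suc n" 0])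
      (auto simp: cofactor_def mat_of_rows_list_def intro!: sum.cong)
qed

text \<open>
  Twice the determinant. The type is an arbitrary integral domain because the polynomial is evaluated
  both at numbers and at formal power series.
\<close>

definition compat_poly :: "'a \<Rightarrow> 'a \<Rightarrow> 'a \<Rightarrow> 'a \<Rightarrow> 'a \<Rightarrow> 'a \<Rightarrow> 'a::idom" where
  "compat_poly r t F F1 F2 F3 =
     48 * F2^2 - 32 * F1 * F3 + 48 * r * t * F1 - 72 * r * t^2 * F2 + 8 * r * t^3 * F3
     + 15 * r^2 * t^4 + 128 * F1^3 * F2 + 24 * r * F^2 * F1 + 96 * r * t * F * F1^2
     - 48 * r * t * F^2 * F2 - 96 * r * t^2 * F1^3 - 96 * r * t^3 * F1^2 * F2
     + 30 * r^2 * t^3 * F^2 - 96 * r^2 * t^4 * F * F1 + 48 * r^2 * t^5 * F1^2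
     + 24 * r^2 * t^5 * F * F2 + 24 * r^2 * t^6 * F1 * F2 - 4 * r^3 * t^9 * F2 - 64 * F1^6
     + 16 * r * F^3 * F1^2 - 96 * r * t^2 * F * F1^4 + 96 * r * t^3 * F1^5
     + 9 * r^2 * t^2 * F^4 - 8 * r^2 * t^3 * F^3 * F1 - 48 * r^2 * t^4 * F^2 * F1^2
     + 96 * r^2 * t^5 * F * F1^3 - 48 * r^2 * t^6 * F1^4 - 8 * r^3 * t^6 * F^3
     + 24 * r^3 * t^7 * F^2 * F1 - 24 * r^3 * t^8 * F * F1^2 + 8 * r^3 * t^9 * F1^3"

text \<open>
  The pattern of zeros and ones of the compatibility matrix, with \<open>a1\<close> for its three entries
  \<open>\<rho> t\<^sup>3\<close>. With opaque entries the expansion stays small; doubling removes the entry \<open>1/2\<close>, so that the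
  result has integer coefficients and makes sense for power series as well.
\<close>

lemma det_compat_shape:
  fixes h :: "'a::comm_ring_1"
  assumes h: "2 * h = 1"
  shows "2 * Determinant.det (mat_of_rows_list 6
    [[1, a1, a2, a3, a4, a5], [h, b1, b2, b3, b4, b5], [0, 1, a1, c3, c4, c5],
     [0, 0, 1, d3, d4, d5], [0, 0, 1, a1, e4, e5], [0, 0, 0, 0, 1, k]]) =
     2 * (b1 *
       (a1 * (d3 * (e4 * k - e5) - a1 * (d4 * k - d5)) -
        (c3 * (e4 * k - e5) - a1 * (c4 * k - c5)) +
        (c3 * (d4 * k - d5) - d3 * (c4 * k - c5))) -
      (b2 * (d3 * (e4 * k - e5) - a1 * (d4 * k - d5)) -
       (b3 * (e4 * k - e5) - a1 * (b4 * k - b5)) +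
       (b3 * (d4 * k - d5) - d3 * (b4 * k - b5)))) -
     (a1 *
       (a1 * (d3 * (e4 * k - e5) - a1 * (d4 * k - d5)) -
        (c3 * (e4 * k - e5) - a1 * (c4 * k - c5)) +
        (c3 * (d4 * k - d5) - d3 * (c4 * k - c5))) -
      (a2 * (d3 * (e4 * k - e5) - a1 * (d4 * k - d5)) -
       (a3 * (e4 * k - e5) - a1 * (a4 * k - a5)) +
       (a3 * (d4 * k - d5) - d3 * (a4 * k - a5))))"
  (is "2 * Determinant.det ?M = 2 * ?B - ?H")
proof -
  note expand = det_rows_expand_first_column
  have size: "(6::nat) = Suc (Suc (Suc (Suc (Suc (Suc 0)))))" by simp
  have det0: "Determinant.det (mat_of_rows_list 0 ([]::'a list list)) = 1"
    by (simp add: mat_of_rows_list_def)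
  have "Determinant.det ?M = ?B - h * ?H"
    unfolding size
    \<comment> \<open>One size at a time: each call to the simplifier discards the minors that are multiplied by
      a zero entry before they are expanded further.\<close>
    apply (simp add: expand[where n = "Suc (Suc (Suc (Suc (Suc 0))))"])
    apply (simp add: expand[where n = "Suc (Suc (Suc (Suc 0)))"])
    apply (simp add: expand[where n = "Suc (Suc (Suc 0))"])
    apply (simp add: expand[where n = "Suc (Suc 0)"])
    apply (simp add: expand[where n = "Suc 0"])
    apply (simp add: expand[where n = 0] det0)
    done
  then have "2 * Determinant.det ?M = 2 * ?B - (2 * h) * ?H"
    by (simp only: right_diff_distrib mult.assoc)
  then show ?thesis
    unfolding h by simp
qed

lemma det_compat_matrix:
  fixes f :: "'a::{real_normed_field, banach} \<Rightarrow> 'a"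
  shows "2 * Determinant.det (compat_matrix rho f t) =
     compat_poly (of_real rho) t (f t) (deriv f t) ((deriv ^^ 2) f t) ((deriv ^^ 3) f t)"
proof -
  have half: "2 * (1/2 :: 'a) = 1" by simp
  show ?thesis
    unfolding compat_matrix_def Let_def det_compat_shape[OF half] compat_poly_def
    by (simp add: algebra_simps eval_nat_numeral del: funpow.simps)
qed

section \<open>The graded form of the equation\<close>

text \<open>
  The parts of \<^const>\<open>compat_poly\<close> of weight 4, 11 and 18, when \<open>t\<close> has weight 1 and the
  \<open>k\<close>-th derivative of \<open>F\<close> has weight \<open>4 - k\<close>, written in the rescaled unknowns \<open>u\<^sub>k = t\<^sup>k F\<^bsup>(k)\<^esup> / (c t\<^sup>4)\<close>.
\<close>

definition lead_poly :: "'a \<Rightarrow> 'a \<Rightarrow> 'a \<Rightarrow> 'a::idom" where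
  "lead_poly u1 u2 u3 = 240 + 8 * u3 - 72 * u2 + 3 * u2^2 + 48 * u1 - 2 * u1 * u3"

definition mid_poly :: "'a \<Rightarrow> 'a \<Rightarrow> 'a \<Rightarrow> 'a::idom" where
  "mid_poly u0 u1 u2 =
     192 * u1 * u2 - 512 * u2 + 384 * u1^2 - 48 * u1^2 * u2 - 48 * u1^3 + 4 * u1^3 * u2
     + 192 * u0 * u2 - 768 * u0 * u1 + 48 * u0 * u1^2 + 240 * u0^2 - 24 * u0^2 * u2
     + 12 * u0^2 * u1"

definition top_poly :: "'a \<Rightarrow> 'a \<Rightarrow> 'a::idom" where
  "top_poly u0 u1 =
     512 * u1^3 - 192 * u1^4 + 24 * u1^5 - u1^6 - 1536 * u0 * u1^2 + 384 * u0 * u1^3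
     - 24 * u0 * u1^4 + 1536 * u0^2 * u1 - 192 * u0^2 * u1^2 - 512 * u0^3 - 32 * u0^3 * u1
     + 4 * u0^3 * u1^2 + 36 * u0^4"

definition red_poly :: "'a \<Rightarrow> 'a \<Rightarrow> 'a \<Rightarrow> 'a \<Rightarrow> 'a \<Rightarrow> 'a::idom" where
  "red_poly x u0 u1 u2 u3 =
     lead_poly u1 u2 u3 + x * mid_poly u0 u1 u2 + x^2 * top_poly u0 u1"

lemma compat_poly_graded:
  "compat_poly (16 * c) t (c * t^4 * u0) (c * t^3 * u1) (c * t^2 * u2) (c * t * u3) =
     16 * c^2 * t^4 * red_poly (2 * c^2 * t^7) u0 u1 u2 u3"
  unfolding compat_poly_def red_poly_def lead_poly_def mid_poly_def top_poly_def
  by (simp add: algebra_simps power_mult_distrib eval_nat_numeral)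

text \<open>
  Here \<open>(4, 12, 24)\<close> are the falling factors of the exponent 4, and \<open>y\<close> is the deviation from the
  leading term \<open>c t\<^sup>4\<close>. The absence of linear terms expresses the double root. In the next lemma the constant
  term is absent: this is why order \<open>x\<^sup>1\<close> imposes no condition.
\<close>

lemma lead_poly_shift:
  "lead_poly (4 + y1) (12 + y2) (24 + y3) = 3 * y2^2 - 2 * y1 * y3"
  unfolding lead_poly_def by (simp add: algebra_simps eval_nat_numeral)

lemma mid_poly_shift:
  "mid_poly (1 + y0) (4 + y1) (12 + y2) =
     396 * y1 - 88 * y2 - 144 * y1^2 + 144 * y0 * y2 - 360 * y0 * y1 + 48 * y0 * y1^2
     - 24 * y0^2 * y2 + 12 * y0^2 * y1 + 4 * y1^3 * y2"
  unfolding mid_poly_def by (simp add: algebra_simps eval_nat_numeral)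

lemma top_poly_shift:
  "top_poly (1 + y0) (4 + y1) =
     484 - 1584 * y0 - 188 * y1^2 + 1560 * y0^2 + 396 * y0 * y1^2 - 432 * y0^3 + 24 * y1^4
     - 180 * y0^2 * y1^2 + 36 * y0^4 - 24 * y0 * y1^4 + 4 * y0^3 * y1^2 - y1^6"
  unfolding top_poly_def by (simp add: algebra_simps eval_nat_numeral)

text \<open>
  What remains after the lowest-order part has been split off. The majorant argument needs to know only
  that this is a polynomial.
\<close>

definition tail_poly :: "'a \<Rightarrow> 'a \<Rightarrow> 'a \<Rightarrow> 'a \<Rightarrow> 'a::idom" where
  "tail_poly x g0 g1 g2 =
     144*g0*g2 - 144*g1^2 - 1584*g0 - 360*g0*g1 - 188*x*g1^2 + 48*x*g0*g1^2 + 1560*x*g0^2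
     - 24*x*g0^2*g2 + 12*x*g0^2*g1 + 4*x^2*g1^3*g2 + 396*x^2*g0*g1^2 - 432*x^2*g0^3
     + 24*x^3*g1^4 - 180*x^3*g0^2*g1^2 + 36*x^3*g0^4 - 24*x^4*g0*g1^4 + 4*x^4*g0^3*g1^2
     - x^5*g1^6"

lemma red_poly_first_order:
  "red_poly x (1 + x * g0) (4 + x * g1) (12 + x * g2) (24 + x * g3) =
     x^2 * (3 * g2^2 - 2 * g1 * g3 - 88 * g2 + 396 * g1 + 484) + x^3 * tail_poly x g0 g1 g2"
  unfolding tail_poly_def red_poly_def lead_poly_shift mid_poly_shift top_poly_shift
  by (simp add: algebra_simps power_mult_distrib eval_nat_numeral)

text \<open>
  The numbers \<open>(1, 11, 110, 990)\<close> are the falling factors of the exponent 11. In the cofactor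
  of \<open>x\<^sup>3\<close> the new unknowns \<open>h\<close> occur linearly, and in every other place with a further factor \<open>x\<close>; so
  they are determined recursively.
\<close>

lemma red_poly_second_order:
  "red_poly x (1 + x * (a + x * h0)) (4 + x * (11 * a + x * h1)) (12 + x * (110 * a + x * h2))
       (24 + x * (990 * a + x * h3)) =
     x^2 * (484 * (30 * a^2 - 11 * a + 1)) +
     x^3 * (a * (660 * h2 - 22 * h3 - 1980 * h1) - 88 * h2 + 396 * h1
            + tail_poly x (a + x * h0) (11 * a + x * h1) (110 * a + x * h2)
            + x * (3 * h2^2 - 2 * h1 * h3))"
  unfolding red_poly_first_order by (simp add: algebra_simps eval_nat_numeral)

section \<open>Taylor expansions and the compatibility condition\<close>

lemma fps_nth_eq_higher_deriv:
  fixes F :: "'a::{real_normed_field, banach} \<Rightarrow> 'a"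
  assumes "F has_fps_expansion P"
  shows "fps_nth P n = (deriv ^^ n) F 0 / fact n"
proof -
  have "(deriv ^^ n) F has_fps_expansion (fps_deriv ^^ n) P"
    by (induction n) (auto intro: has_fps_expansion_deriv assms)
  then have "fps_nth ((fps_deriv ^^ n) P) 0 = (deriv ^^ n) F 0"
    by (auto simp: has_fps_expansion_def eval_fps_at_0 dest: eventually_nhds_x_imp_x)
  then show ?thesis
    by (simp add: fps_0th_higher_deriv field_simps)
qed

lemma has_fps_expansion_unique:
  fixes F :: "'a::{real_normed_field, banach} \<Rightarrow> 'a"
  assumes "F has_fps_expansion P" "F has_fps_expansion Q"
  shows "P = Q"
  using assms by (intro fps_ext) (simp add: fps_nth_eq_higher_deriv)

lemma has_fps_expansion_transfer:
  assumes "F has_fps_expansion P" "\<forall>\<^sub>F t in nhds 0. F t = G t"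
  shows "G has_fps_expansion P"
  using assms unfolding has_fps_expansion_def by (auto elim: eventually_elim2)

lemma has_fps_expansion_pow:
  fixes F :: "'a::{real_normed_field, banach} \<Rightarrow> 'a"
  assumes "F has_fps_expansion P"
  shows "(\<lambda>t. F t ^ n) has_fps_expansion P ^ n"
  by (induction n) (auto intro!: has_fps_expansion_mult assms)

lemma compat_condition_iff:
  fixes F :: "'a::{real_normed_field, banach} \<Rightarrow> 'a"
  assumes F: "F has_fps_expansion P"
  shows "compat_condition rho F \<longleftrightarrow>
    compat_poly (fps_const (of_real rho)) fps_X P (fps_deriv P) (fps_deriv (fps_deriv P))
      (fps_deriv (fps_deriv (fps_deriv P))) = 0"
    (is "_ \<longleftrightarrow> ?C = 0")
proof -
  let ?D = "\<lambda>t. 2 * Determinant.det (compat_matrix rho F t)"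
  note F1 = has_fps_expansion_deriv[OF F]
  note F2 = has_fps_expansion_deriv[OF F1]
  note F3 = has_fps_expansion_deriv[OF F2]
  have D: "?D has_fps_expansion ?C"
    unfolding det_compat_matrix compat_poly_def numeral_2_eq_2 numeral_3_eq_3 funpow.simps o_def id_def
    by (intro has_fps_expansion_add has_fps_expansion_diff has_fps_expansion_mult
        has_fps_expansion_pow has_fps_expansion_numeral has_fps_expansion_const
        has_fps_expansion_fps_X F F1 F2 F3)
  have "compat_condition rho F \<longleftrightarrow> (\<forall>\<^sub>F t in nhds 0. ?D t = 0)"
    by (simp add: compat_condition_def)
  also have "\<dots> \<longleftrightarrow> ?C = 0"
  proof
    assume zero: "\<forall>\<^sub>F t in nhds 0. ?D t = 0"
    show "?C = 0"
      by (rule has_fps_expansion_unique[OF has_fps_expansion_transfer[OF D zero] has_fps_expansion_0])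
  next
    assume "?C = 0"
    then have "\<forall>\<^sub>F t in nhds 0. eval_fps 0 t = ?D t"
      using D by (simp only: has_fps_expansion_def)
    then show "\<forall>\<^sub>F t in nhds 0. ?D t = 0"
      by (rule eventually_mono) (simp only: eval_fps_0)
  qed
  finally show ?thesis .
qed

section \<open>Series of graded shape\<close>

lemma fps_nth_compose_monomial:
  fixes f :: "'a::idom fps"
  assumes "k > 0"
  shows "fps_nth (f oo (fps_const d * fps_X ^ k)) n =
    (if k dvd n then fps_nth f (n div k) * d ^ (n div k) else 0)"
proof -
  have "fps_nth ((fps_const d * fps_X ^ k) ^ i) n = (if n = k * i then d ^ i else 0)" for i
    by (simp add: power_mult_distrib fps_const_power flip: power_mult)
  then have "fps_nth (f oo (fps_const d * fps_X ^ k)) n =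
      (\<Sum>i = 0..n. if n = k * i then fps_nth f i * d ^ i else 0)"
    by (auto simp: fps_compose_nth intro!: sum.cong)
  also have "\<dots> = (\<Sum>i = 0..n. if i = n div k then (if k dvd n then fps_nth f i * d ^ i else 0) else 0)"
    using assms by (intro sum.cong) auto
  also have "\<dots> = (if k dvd n then fps_nth f (n div k) * d ^ (n div k) else 0)"
    by (simp add: sum.delta)
  finally show ?thesis .
qed

definition falling :: "nat \<Rightarrow> nat \<Rightarrow> nat" where
  "falling k n = (\<Prod>i<k. n - i)"

text \<open>
  The series \<open>\<phi>\<^sub>k\<close> for which \<open>t\<^sup>k F\<^bsup>(k)\<^esup> = c t\<^sup>4 \<phi>\<^sub>k(x)\<close>.
\<close>

definition euler_fps :: "nat \<Rightarrow> (nat \<Rightarrow> 'a) \<Rightarrow> 'a::idom fps" where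
  "euler_fps k A = Abs_fps (\<lambda>m. of_nat (falling k (7 * m + 4)) * A m)"

text \<open>
  The substitution of \<open>x = 2 c\<^sup>2 t\<^sup>7\<close>, which equals \<open>\<rho>\<^sup>2 (t/2)\<^sup>7\<close> for \<open>c = \<rho>/16\<close>. Working with \<open>c\<close>
  instead of \<open>\<rho>\<close> and \<open>t/2\<close> keeps all numerical factors integral.
\<close>

definition subst7 :: "'a::idom \<Rightarrow> 'a fps \<Rightarrow> 'a fps" where
  "subst7 c f = f oo (fps_const (2 * c^2) * fps_X^7)"

definition graded_fps :: "'a::idom \<Rightarrow> (nat \<Rightarrow> 'a) \<Rightarrow> 'a fps" where
  "graded_fps c A = fps_const c * fps_X^4 * subst7 c (Abs_fps A)"

lemma fps_nth_graded_fps: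
  "fps_nth (graded_fps c A) n =
    (if 4 \<le> n \<and> 7 dvd n - 4 then c * (2 * c^2) ^ ((n - 4) div 7) * A ((n - 4) div 7) else 0)"
  by (simp add: graded_fps_def subst7_def mult.assoc fps_X_power_mult_nth fps_nth_compose_monomial)

text \<open>
  By the chain rule, since \<open>x\<close> is a monomial of degree 7 in \<open>t\<close>, so that \<open>t dx/dt = 7 x\<close>.
\<close>

lemma fps_deriv_graded:
  fixes f :: "'a::idom fps"
  shows "fps_deriv (fps_const c * fps_X ^ Suc j * subst7 c f) =
    fps_const c * fps_X ^ j * subst7 c (of_nat (Suc j) * f + 7 * fps_X * fps_deriv f)"
proof -
  define y :: "'a fps" where "y = fps_const (2 * c^2) * fps_X^7"
  have y0: "fps_nth y 0 = 0" by (simp add: y_def)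
  have "fps_X * fps_deriv y = 7 * y"
    by (simp add: y_def fps_deriv_power eval_nat_numeral algebra_simps)
  then have chain: "fps_X ^ Suc j * ((fps_deriv f oo y) * fps_deriv y) =
      fps_X ^ j * (7 * y * (fps_deriv f oo y))"
    by (simp add: mult_ac)
  have power: "fps_deriv (fps_X ^ Suc j :: 'a fps) = of_nat (Suc j) * fps_X ^ j"
    by (simp add: fps_deriv_power fps_of_nat del: of_nat_Suc power_Suc)
  have "fps_deriv (fps_const c * fps_X ^ Suc j * (f oo y)) =
      fps_const c * (of_nat (Suc j) * fps_X ^ j * (f oo y) +
        fps_X ^ Suc j * ((fps_deriv f oo y) * fps_deriv y))"
    by (simp add: power fps_compose_deriv[OF y0] distrib_left mult.assoc add.commute
        del: of_nat_Suc power_Suc)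
  also have "\<dots> = fps_const c * fps_X ^ j * (of_nat (Suc j) * (f oo y) + 7 * y * (fps_deriv f oo y))"
    unfolding chain by (simp add: distrib_left mult_ac del: of_nat_Suc)
  also have "of_nat (Suc j) * (f oo y) + 7 * y * (fps_deriv f oo y) =
      (of_nat (Suc j) * f + 7 * fps_X * fps_deriv f) oo y"
    by (simp add: fps_compose_add_distrib fps_compose_mult_distrib[OF y0] y0 fps_of_nat[symmetric]
        del: of_nat_Suc)
  finally show ?thesis
    unfolding subst7_def y_def .
qed

lemma fps_deriv_euler_fps:
  assumes "k < 4"
  shows "fps_deriv (fps_const c * fps_X ^ (4 - k) * subst7 c (euler_fps k A)) =
    fps_const c * fps_X ^ (3 - k) * subst7 c (euler_fps (Suc k) A)"
proof -
  have j: "4 - k = Suc (3 - k)" using assms by simp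
  define d where "d = 4 - k"
  have "of_nat d * euler_fps k A + 7 * fps_X * fps_deriv (euler_fps k A) = euler_fps (Suc k) A"
  proof (rule fps_ext)
    fix m
    have "falling (Suc k) (7 * m + 4) = (7 * m + d) * falling k (7 * m + 4)"
      using assms by (simp add: falling_def d_def)
    then show "fps_nth (of_nat d * euler_fps k A + 7 * fps_X * fps_deriv (euler_fps k A)) m =
        fps_nth (euler_fps (Suc k) A) m"
      by (cases m) (simp_all add: euler_fps_def mult.assoc algebra_simps flip: fps_of_nat)
  qed
  then show ?thesis
    unfolding j fps_deriv_graded d_def by simp
qed

lemma subst7_red_poly:
  "subst7 c (red_poly fps_X u0 u1 u2 u3) = red_poly (fps_const (2 * c^2) * fps_X^7)
     (subst7 c u0) (subst7 c u1) (subst7 c u2) (subst7 c u3)"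
  by (simp add: subst7_def red_poly_def lead_poly_def mid_poly_def top_poly_def
      fps_compose_add_distrib fps_compose_sub_distrib fps_compose_mult_distrib
      fps_compose_power[symmetric])

lemma compat_poly_graded_fps:
  fixes c :: "'a::idom"
  assumes "P = graded_fps c A"
  shows "compat_poly (fps_const (16 * c)) fps_X P (fps_deriv P) (fps_deriv (fps_deriv P))
      (fps_deriv (fps_deriv (fps_deriv P))) =
    16 * fps_const c ^ 2 * fps_X^4 *
      subst7 c (red_poly fps_X (euler_fps 0 A) (euler_fps 1 A) (euler_fps 2 A) (euler_fps 3 A))"
proof -
  have P: "P = fps_const c * fps_X^4 * subst7 c (euler_fps 0 A)"
    by (simp add: assms graded_fps_def euler_fps_def falling_def)
  have P1: "fps_deriv P = fps_const c * fps_X^3 * subst7 c (euler_fps 1 A)"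
    using fps_deriv_euler_fps[of 0 c A] by (simp add: P)
  have P2: "fps_deriv (fps_deriv P) = fps_const c * fps_X^2 * subst7 c (euler_fps 2 A)"
    using fps_deriv_euler_fps[of 1 c A] by (simp add: P1 numeral_2_eq_2)
  have P3: "fps_deriv (fps_deriv (fps_deriv P)) = fps_const c * fps_X * subst7 c (euler_fps 3 A)"
    using fps_deriv_euler_fps[of 2 c A] by (simp add: P2 numeral_3_eq_3 numeral_2_eq_2)
  have c: "fps_const (16 * c) = 16 * fps_const c" "fps_const (2 * c^2) = 2 * fps_const c ^ 2"
    by (simp_all add: numeral_fps_const fps_const_power)
  show ?thesis
    unfolding P3 unfolding P2 unfolding P1 unfolding P subst7_red_poly c by (rule compat_poly_graded)
qed

text \<open>
  The substitution of \<open>x\<close> is injective on power series, so the condition may be read off in the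
  variable \<open>x\<close>.
\<close>

lemma compat_condition_graded_iff:
  fixes F :: "'a::{real_normed_field, banach} \<Rightarrow> 'a"
  assumes "rho \<noteq> 0" "F has_fps_expansion graded_fps (of_real (rho / 16)) A"
  shows "compat_condition rho F \<longleftrightarrow>
    red_poly fps_X (euler_fps 0 A) (euler_fps 1 A) (euler_fps 2 A) (euler_fps 3 A) = 0"
proof -
  define c :: 'a where "c = of_real (rho / 16)"
  have c: "of_real rho = 16 * c" "c \<noteq> 0"
    using assms by (simp_all add: c_def)
  show ?thesis
    unfolding compat_condition_iff[OF assms(2)] c(1) compat_poly_graded_fps[OF c_def[symmetric, THEN arg_cong[of _ _ "\<lambda>c. graded_fps c A"]]]
    using c(2) by (simp add: subst7_def fps_compose_eq_0_iff)
qed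

lemma graded_series_sums_iff:
  fixes t :: "'a::{real_normed_field, banach}"
  shows "(\<lambda>n. fps_nth (graded_fps (of_real (rho / 16)) A) n * t ^ n) sums s \<longleftrightarrow>
    (\<lambda>m. A m * of_real rho ^ (2 * m + 1) * (t / 2) ^ (7 * m + 4)) sums s"
proof -
  define c :: 'a where "c = of_real (rho / 16)"
  have c: "of_real rho = 16 * c" by (simp add: c_def)
  define f where "f n = fps_nth (graded_fps c A) n * t ^ n" for n
  have "A m * of_real rho ^ (2 * m + 1) * (t / 2) ^ (7 * m + 4) = f (7 * m + 4)" for m
  proof -
    have "(16 * c) ^ (2 * m + 1) * (t / 2) ^ (7 * m + 4) =
      (16 * c) * ((16 * c)^2) ^ m * (((t / 2)^7) ^ m * (t / 2)^4)"
      by (simp only: power_add power_mult) simp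
    also have "\<dots> = (16 * c * (t / 2)^4) * ((16 * c)^2 * (t / 2)^7) ^ m"
      by (simp only: power_mult_distrib mult_ac)
    also have "16 * c * (t / 2)^4 = c * t^4"
      by (simp add: power_divide)
    also have "(16 * c)^2 * (t / 2)^7 = (2 * c^2) * t^7"
      by (simp add: power_mult_distrib power_divide)
    also have "c * t^4 * ((2 * c^2) * t^7) ^ m = c * (2 * c^2) ^ m * t ^ (7 * m + 4)"
      by (simp only: power_mult_distrib power_add power_mult) simp
    finally show ?thesis
      by (simp add: f_def fps_nth_graded_fps c)
  qed
  moreover have "(\<lambda>m. f (7 * m + 4)) sums s \<longleftrightarrow> f sums s"
  proof (rule sums_mono_reindex)
    show "strict_mono (\<lambda>m::nat. 7 * m + 4)" by (simp add: strict_mono_def)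
    fix n assume n: "n \<notin> range (\<lambda>m::nat. 7 * m + 4)"
    have "\<not> (4 \<le> n \<and> 7 dvd n - 4)"
    proof
      assume "4 \<le> n \<and> 7 dvd n - 4"
      then have "n = 7 * ((n - 4) div 7) + 4" by simp
      with n show False by (blast intro: range_eqI)
    qed
    then show "f n = 0"
      by (simp only: f_def fps_nth_graded_fps if_False mult_zero_left)
  qed
  ultimately show ?thesis
    unfolding c_def[symmetric] f_def[symmetric] by simp
qed

text \<open>
  A convergent series of the graded form is the same thing as a Taylor expansion of graded shape;
  the convergence for all small \<open>t\<close> gives a positive radius, and conversely.
\<close>

lemma graded_analytic_iff:
  fixes F :: "'a::{real_normed_field, banach} \<Rightarrow> 'a"
  shows "graded_analytic rho F \<longleftrightarrow> (\<exists>A. F has_fps_expansion graded_fps (of_real (rho / 16)) A)"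
proof -
  have "(\<forall>\<^sub>F t in nhds 0. (\<lambda>n. fps_nth P n * t ^ n) sums F t) \<longleftrightarrow> F has_fps_expansion P"
    for P
  proof
    assume P: "F has_fps_expansion P"
    then have "\<forall>\<^sub>F t in nhds 0. t \<in> eball 0 (fps_conv_radius P)"
      by (intro eventually_nhds_in_open) (auto simp: has_fps_expansion_def zero_ereal_def)
    moreover have "\<forall>\<^sub>F t in nhds 0. eval_fps P t = F t"
      using P by (simp add: has_fps_expansion_def)
    ultimately show "\<forall>\<^sub>F t in nhds 0. (\<lambda>n. fps_nth P n * t ^ n) sums F t"
      by eventually_elim (use sums_eval_fps in force)
  qed (rule has_fps_expansionI)
  then show ?thesis
    unfolding graded_analytic_def graded_series_sums_iff[symmetric] by simp
qed

section \<open>Truncated norms and tame operators\<close>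

definition trunc_norm :: "nat \<Rightarrow> real \<Rightarrow> 'a::real_normed_field fps \<Rightarrow> real" where
  "trunc_norm M R f = (\<Sum>i<M. norm (fps_nth f i) * R ^ i)"

lemma trunc_norm_nonneg: "0 \<le> R \<Longrightarrow> 0 \<le> trunc_norm M R f"
  by (simp add: trunc_norm_def sum_nonneg)

lemma trunc_norm_add:
  assumes "0 \<le> R"
  shows "trunc_norm M R (f + g) \<le> trunc_norm M R f + trunc_norm M R g"
  unfolding trunc_norm_def sum.distrib[symmetric] distrib_right[symmetric]
  by (intro sum_mono mult_right_mono) (use assms norm_triangle_ineq in auto)

lemma trunc_norm_uminus: "trunc_norm M R (- f) = trunc_norm M R f"
  by (simp add: trunc_norm_def)

lemma trunc_norm_mult:
  assumes R: "0 \<le> R"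
  shows "trunc_norm M R (f * g) \<le> trunc_norm M R f * trunc_norm M R g"
proof -
  define u where "u i = norm (fps_nth f i) * R ^ i" for i
  define v where "v i = norm (fps_nth g i) * R ^ i" for i
  have uv: "0 \<le> u i" "0 \<le> v i" for i
    using R by (auto simp: u_def v_def)
  have "norm (fps_nth (f * g) k) * R ^ k \<le> (\<Sum>i\<le>k. u i * v (k - i))" for k
  proof -
    have "norm (fps_nth (f * g) k) \<le> (\<Sum>i\<le>k. norm (fps_nth f i) * norm (fps_nth g (k - i)))"
      unfolding fps_mult_nth atLeast0AtMost
      by (rule order_trans[OF norm_sum]) (simp add: norm_mult)
    then have "norm (fps_nth (f * g) k) * R ^ k \<le>
        (\<Sum>i\<le>k. norm (fps_nth f i) * norm (fps_nth g (k - i))) * R ^ k"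
      using R by (intro mult_right_mono) auto
    also have "\<dots> = (\<Sum>i\<le>k. u i * v (k - i))"
      unfolding sum_distrib_right u_def v_def
    proof (rule sum.cong)
      fix i assume "i \<in> {..k}"
      then have "R ^ k = R ^ i * R ^ (k - i)" by (simp flip: power_add)
      then show "norm (fps_nth f i) * norm (fps_nth g (k - i)) * R ^ k =
          norm (fps_nth f i) * R ^ i * (norm (fps_nth g (k - i)) * R ^ (k - i))" by simp
    qed simp
    finally show ?thesis .
  qed
  then have "trunc_norm M R (f * g) \<le> (\<Sum>k<M. \<Sum>i\<le>k. u i * v (k - i))"
    unfolding trunc_norm_def by (rule sum_mono)
  also have "\<dots> = (\<Sum>(i, j)\<in>{(i, j). i + j < M}. u i * v j)"
    by (rule sum.triangle_reindex[symmetric])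
  also have "\<dots> \<le> (\<Sum>(i, j)\<in>{..<M} \<times> {..<M}. u i * v j)"
    by (rule sum_mono2) (use uv in auto)
  also have "\<dots> = trunc_norm M R f * trunc_norm M R g"
    by (simp add: trunc_norm_def u_def v_def sum_product sum.cartesian_product)
  finally show ?thesis .
qed

lemma trunc_norm_X_mult: "trunc_norm (Suc M) R (fps_X * f) = R * trunc_norm M R f"
  unfolding trunc_norm_def by (subst sum.lessThan_Suc_shift) (simp add: sum_distrib_left mult_ac)

lemma trunc_norm_const: "trunc_norm (Suc M) R (fps_const c) = norm c"
  unfolding trunc_norm_def by (subst sum.lessThan_Suc_shift) simp

text \<open>
  The right-hand sides that the majorant argument can handle: the first \<open>M\<close> coefficients of the result depend only
  on the first \<open>M\<close> coefficients of the \<open>d\<close> arguments, and bounds on truncated norms are passed on,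
  uniformly in the truncation and in the weight \<open>R \<le> 1\<close>. Every polynomial in the
  arguments and in the variable qualifies, which spares explicit majorants.
\<close>

definition tame :: "nat \<Rightarrow> ((nat \<Rightarrow> 'a::real_normed_field fps) \<Rightarrow> 'a fps) \<Rightarrow> bool" where
  "tame d Q \<longleftrightarrow>
     (\<forall>M g g'. (\<forall>k<d. \<forall>i<M. fps_nth (g k) i = fps_nth (g' k) i) \<longrightarrow>
        (\<forall>i<M. fps_nth (Q g) i = fps_nth (Q g') i)) \<and>
     (\<forall>K. \<exists>B. \<forall>M R g. 0 \<le> R \<longrightarrow> R \<le> 1 \<longrightarrow> (\<forall>k<d. trunc_norm M R (g k) \<le> K) \<longrightarrow>
        trunc_norm M R (Q g) \<le> B)"

lemma tameD_causal:
  "tame d Q \<Longrightarrow> (\<And>k i. k < d \<Longrightarrow> i < M \<Longrightarrow> fps_nth (g k) i = fps_nth (g' k) i) \<Longrightarrow> i < M \<Longrightarrow>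
    fps_nth (Q g) i = fps_nth (Q g') i"
  unfolding tame_def by blast

lemma tameD_bounded:
  assumes "tame d Q"
  obtains B where "\<And>M R g. 0 \<le> R \<Longrightarrow> R \<le> 1 \<Longrightarrow> (\<And>k. k < d \<Longrightarrow> trunc_norm M R (g k) \<le> K) \<Longrightarrow>
    trunc_norm M R (Q g) \<le> B"
  using assms unfolding tame_def by metis

lemma tameI:
  assumes "\<And>M g g' i. (\<And>k i. k < d \<Longrightarrow> i < M \<Longrightarrow> fps_nth (g k) i = fps_nth (g' k) i) \<Longrightarrow> i < M \<Longrightarrow>
    fps_nth (Q g) i = fps_nth (Q g') i"
    and "\<And>K. \<exists>B. \<forall>M R g. 0 \<le> R \<longrightarrow> R \<le> 1 \<longrightarrow> (\<forall>k<d. trunc_norm M R (g k) \<le> K) \<longrightarrow>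
        trunc_norm M R (Q g) \<le> B"
  shows "tame d Q"
  unfolding tame_def using assms by blast

lemma tame_proj: "k < d \<Longrightarrow> tame d (\<lambda>g. g k)"
  by (rule tameI) auto

lemma tame_fixed: 
  assumes "\<And>M R. 0 \<le> R \<Longrightarrow> R \<le> 1 \<Longrightarrow> trunc_norm M R f \<le> B"
  shows "tame d (\<lambda>g. f)"
  by (rule tameI) (use assms in auto)

lemma tame_numeral: "tame d (\<lambda>g. numeral n)"
proof (rule tame_fixed)
  fix M R assume "0 \<le> (R::real)"
  show "trunc_norm M R (numeral n :: 'a fps) \<le> norm (numeral n :: 'a)"
    by (cases M) (simp_all only: numeral_fps_const trunc_norm_const, simp add: trunc_norm_def)
qed

lemma tame_X: "tame d (\<lambda>g. fps_X)"
proof (rule tame_fixed)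
  fix M R assume R: "0 \<le> (R::real)" "R \<le> 1"
  have "trunc_norm M R (1 :: 'a fps) \<le> 1" for M
    by (cases M) (use trunc_norm_const[of _ R "1::'a"] in \<open>auto simp: trunc_norm_def\<close>)
  from mult_mono[OF R(2) this] show "trunc_norm M R (fps_X :: 'a fps) \<le> 1"
    using trunc_norm_X_mult[of _ R "1::'a fps"] trunc_norm_nonneg[of R _ "1 :: 'a fps"] R
    by (cases M) (auto simp: trunc_norm_def)
qed

lemma tame_add:
  fixes P Q :: "(nat \<Rightarrow> 'a::real_normed_field fps) \<Rightarrow> 'a fps"
  assumes P: "tame d P" and Q: "tame d Q"
  shows "tame d (\<lambda>g. P g + Q g)"
proof (rule tameI)
  fix M i and g g' :: "nat \<Rightarrow> 'a fps"
  assume "\<And>k i. k < d \<Longrightarrow> i < M \<Longrightarrow> fps_nth (g k) i = fps_nth (g' k) i" "i < M"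
  then show "fps_nth (P g + Q g) i = fps_nth (P g' + Q g') i"
    using tameD_causal[OF P, of M g g' i] tameD_causal[OF Q, of M g g' i] by simp
next
  fix K
  obtain A where A: "\<And>M R g. 0 \<le> R \<Longrightarrow> R \<le> 1 \<Longrightarrow> (\<And>k. k < d \<Longrightarrow> trunc_norm M R (g k) \<le> K) \<Longrightarrow>
    trunc_norm M R (P g) \<le> A" using tameD_bounded[OF P, of K] by metis
  obtain B where B: "\<And>M R g. 0 \<le> R \<Longrightarrow> R \<le> 1 \<Longrightarrow> (\<And>k. k < d \<Longrightarrow> trunc_norm M R (g k) \<le> K) \<Longrightarrow>
    trunc_norm M R (Q g) \<le> B" using tameD_bounded[OF Q, of K] by metis
  show "\<exists>B. \<forall>M R g. 0 \<le> R \<longrightarrow> R \<le> 1 \<longrightarrow> (\<forall>k<d. trunc_norm M R (g k) \<le> K) \<longrightarrow>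
      trunc_norm M R (P g + Q g) \<le> B"
  proof (intro exI allI impI)
    fix M R and g :: "nat \<Rightarrow> 'a fps"
    assume "0 \<le> R" "R \<le> 1" "\<forall>k<d. trunc_norm M R (g k) \<le> K"
    then show "trunc_norm M R (P g + Q g) \<le> A + B"
      using trunc_norm_add[of R M "P g" "Q g"] A[of R M g] B[of R M g] by simp
  qed
qed

lemma tame_mult:
  fixes P Q :: "(nat \<Rightarrow> 'a::real_normed_field fps) \<Rightarrow> 'a fps"
  assumes P: "tame d P" and Q: "tame d Q"
  shows "tame d (\<lambda>g. P g * Q g)"
proof (rule tameI)
  fix M i and g g' :: "nat \<Rightarrow> 'a fps"
  assume *: "\<And>k i. k < d \<Longrightarrow> i < M \<Longrightarrow> fps_nth (g k) i = fps_nth (g' k) i" "i < M"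
  have "fps_nth (P g) j = fps_nth (P g') j" "fps_nth (Q g) j = fps_nth (Q g') j" if "j \<le> i" for j
    using tameD_causal[OF P, of M g g' j] tameD_causal[OF Q, of M g g' j] * that by auto
  then show "fps_nth (P g * Q g) i = fps_nth (P g' * Q g') i"
    unfolding fps_mult_nth by (intro sum.cong) auto
next
  fix K
  obtain A where A: "\<And>M R g. 0 \<le> R \<Longrightarrow> R \<le> 1 \<Longrightarrow> (\<And>k. k < d \<Longrightarrow> trunc_norm M R (g k) \<le> K) \<Longrightarrow>
    trunc_norm M R (P g) \<le> A" using tameD_bounded[OF P, of K] by metis
  obtain B where B: "\<And>M R g. 0 \<le> R \<Longrightarrow> R \<le> 1 \<Longrightarrow> (\<And>k. k < d \<Longrightarrow> trunc_norm M R (g k) \<le> K) \<Longrightarrow>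
    trunc_norm M R (Q g) \<le> B" using tameD_bounded[OF Q, of K] by metis
  show "\<exists>B. \<forall>M R g. 0 \<le> R \<longrightarrow> R \<le> 1 \<longrightarrow> (\<forall>k<d. trunc_norm M R (g k) \<le> K) \<longrightarrow>
      trunc_norm M R (P g * Q g) \<le> B"
  proof (intro exI allI impI)
    fix M R and g :: "nat \<Rightarrow> 'a fps"
    assume *: "0 \<le> R" "R \<le> 1" "\<forall>k<d. trunc_norm M R (g k) \<le> K"
    then have "trunc_norm M R (P g) \<le> A" "trunc_norm M R (Q g) \<le> B"
      using A[of R M g] B[of R M g] by auto
    then have "trunc_norm M R (P g) * trunc_norm M R (Q g) \<le> A * B"
      using trunc_norm_nonneg[OF *(1)] by (intro mult_mono) (auto intro: order_trans)
    then show "trunc_norm M R (P g * Q g) \<le> A * B"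
      using trunc_norm_mult[OF *(1), of M "P g" "Q g"] by linarith
  qed
qed

lemma tame_uminus: "tame d Q \<Longrightarrow> tame d (\<lambda>g. - Q g)"
  by (simp add: tame_def trunc_norm_uminus)

lemma tame_diff: "tame d P \<Longrightarrow> tame d Q \<Longrightarrow> tame d (\<lambda>g. P g - Q g)"
  using tame_add[of d P "\<lambda>g. - Q g"] by (simp add: tame_uminus)

lemma tame_power: "tame d Q \<Longrightarrow> tame d (\<lambda>g. Q g ^ n)"
  by (induction n) (use tame_numeral[of d num.One] in \<open>simp_all add: tame_mult numeral_One\<close>)

section \<open>Convergence of causal recursions\<close>

definition weighted :: "(nat \<Rightarrow> nat \<Rightarrow> 'a) \<Rightarrow> (nat \<Rightarrow> 'a) \<Rightarrow> nat \<Rightarrow> 'a::comm_ring_1 fps" where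
  "weighted w b k = Abs_fps (\<lambda>m. w k m * b m)"

text \<open>
  The recursion \<open>p m b m = - [x\<^sup>m] (Q (c + x h) + x T h)\<close>, where \<open>h k\<close> is the series with coefficients
  \<open>w k m b m\<close>. Both terms on the right reach back only to coefficients below \<open>m\<close>, and the
  weights \<open>w\<close>, which stand for derivatives, are dominated by the divisor \<open>p\<close>.
\<close>

locale causal_recursion =
  fixes d :: nat and Q T :: "(nat \<Rightarrow> 'a::real_normed_field fps) \<Rightarrow> 'a fps"
    and p c :: "nat \<Rightarrow> 'a" and w :: "nat \<Rightarrow> nat \<Rightarrow> 'a" and C :: real
  assumes Q: "tame d Q" and T: "tame d T"
    and p_nonzero: "p m \<noteq> 0"
    and w_le: "k < d \<Longrightarrow> norm (w k m) \<le> C * norm (p m)"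
begin

definition rhs :: "(nat \<Rightarrow> 'a) \<Rightarrow> 'a fps" where
  "rhs b = Q (\<lambda>k. fps_const (c k) + fps_X * weighted w b k) + fps_X * T (weighted w b)"

definition solution :: "(nat \<Rightarrow> 'a) \<Rightarrow> bool" where
  "solution b \<longleftrightarrow> (\<forall>m. p m * b m + fps_nth (rhs b) m = 0)"

lemma rhs_causal:
  assumes "\<And>i. i < m \<Longrightarrow> b i = b' i"
  shows "fps_nth (rhs b) m = fps_nth (rhs b') m"
proof -
  have W: "fps_nth (weighted w b k) i = fps_nth (weighted w b' k) i" if "i < m" for k i
    using assms that by (simp add: weighted_def)
  have "fps_nth (Q (\<lambda>k. fps_const (c k) + fps_X * weighted w b k)) m =
      fps_nth (Q (\<lambda>k. fps_const (c k) + fps_X * weighted w b' k)) m"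
    by (rule tameD_causal[OF Q, of "Suc m"]) (use W in auto)
  moreover have "fps_nth (fps_X * T (weighted w b)) m = fps_nth (fps_X * T (weighted w b')) m"
    using tameD_causal[OF T, of m "weighted w b" "weighted w b'" "m - 1"] W by auto
  ultimately show ?thesis by (simp add: rhs_def)
qed

lemma solution_unique:
  assumes "solution b" "solution b'"
  shows "b = b'"
proof
  fix m show "b m = b' m"
  proof (induction m rule: less_induct)
    case (less m)
    then have "fps_nth (rhs b) m = fps_nth (rhs b') m" by (rule rhs_causal)
    then have "p m * b m = p m * b' m"
      using assms unfolding solution_def by (metis add_right_cancel)
    then show ?case using p_nonzero by simp
  qed
qed

text \<open>
  Course-of-values recursion along \<^const>\<open>less_than\<close>, made available by \<open>rhs_causal\<close>.
\<close>

lemma solution_exists: "\<exists>b. solution b"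
proof -
  define step where "step b m = - fps_nth (rhs b) m / p m" for b m
  have "adm_wf less_than step"
    unfolding adm_wf_def step_def using rhs_causal by (metis less_than_iff)
  then have "wfrec less_than step = step (wfrec less_than step)"
    by (intro wfrec_fixpoint) auto
  then have "wfrec less_than step m = step (wfrec less_than step) m" for m
    by metis
  then have "solution (wfrec less_than step)"
    unfolding solution_def step_def using p_nonzero by (simp add: field_simps)
  then show ?thesis by blast
qed

text \<open>
  The argument \<open>c + x h\<close> of \<open>Q\<close> has norm at most \<open>K = \<Sum>|c k| + 1\<close> as soon as \<open>R s \<le> 1\<close>, where \<open>s\<close> bounds
  \<open>h\<close>. So the bound \<open>B\<close> for \<open>Q\<close> can be chosen before \<open>s\<close>, and \<open>T\<close>, whose bound depends on \<open>s\<close>,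
  is multiplied by \<open>R\<close>, which is chosen last. The extra factor \<open>x\<close> on every occurrence of \<open>h\<close> lets the
  estimate pass from truncation \<open>M\<close> to truncation \<open>M + 1\<close>.
\<close>

lemma solution_bounded:
  assumes b: "solution b"
  shows "\<exists>R>0. \<exists>s. \<forall>M. \<forall>k<d. trunc_norm M R (weighted w b k) \<le> s"
proof -
  define K where "K = (\<Sum>k<d. norm (c k)) + 1"
  obtain B where B: "\<And>M R g. 0 \<le> R \<Longrightarrow> R \<le> 1 \<Longrightarrow> (\<And>k. k < d \<Longrightarrow> trunc_norm M R (g k) \<le> K) \<Longrightarrow>
    trunc_norm M R (Q g) \<le> B" using tameD_bounded[OF Q, of K] by metis
  define s where "s = \<bar>C\<bar> * (B + 1)"
  obtain D where D: "\<And>M R g. 0 \<le> R \<Longrightarrow> R \<le> 1 \<Longrightarrow> (\<And>k. k < d \<Longrightarrow> trunc_norm M R (g k) \<le> s) \<Longrightarrow>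
    trunc_norm M R (T g) \<le> D" using tameD_bounded[OF T, of s] by metis
  define R where "R = 1 / (1 + \<bar>s\<bar> + \<bar>D\<bar>)"
  have R: "0 < R" "R \<le> 1" "R * s \<le> 1" "R * D \<le> 1"
    by (auto simp: R_def field_simps)
  have "0 \<le> s" if "0 < d" 
  proof -
    have "0 \<le> K" by (simp add: K_def sum_nonneg add_nonneg_nonneg)
    then have "trunc_norm 0 0 (Q (\<lambda>_. 0)) \<le> B"
      by (intro B) (auto simp: trunc_norm_def)
    then show ?thesis by (simp add: s_def trunc_norm_def)
  qed
  have "\<forall>k<d. trunc_norm M R (weighted w b k) \<le> s" for M
  proof (induction M)
    case 0
    then show ?case using \<open>0 < d \<Longrightarrow> 0 \<le> s\<close> by (auto simp: trunc_norm_def)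
  next
    case (Suc M)
    have "trunc_norm (Suc M) R (fps_const (c k) + fps_X * weighted w b k) \<le> K" if "k < d" for k
    proof -
      have "trunc_norm (Suc M) R (fps_const (c k) + fps_X * weighted w b k) \<le>
          norm (c k) + R * trunc_norm M R (weighted w b k)"
        using trunc_norm_add[of R "Suc M"] R by (simp flip: trunc_norm_const[of M R] trunc_norm_X_mult)
      moreover have "R * trunc_norm M R (weighted w b k) \<le> R * s"
        using Suc that R by (intro mult_left_mono) auto
      moreover have "norm (c k) \<le> (\<Sum>k<d. norm (c k))"
        using that by (intro member_le_sum) auto
      ultimately show ?thesis using R(3) unfolding K_def by linarith
    qed
    then have "trunc_norm (Suc M) R (Q (\<lambda>k. fps_const (c k) + fps_X * weighted w b k)) \<le> B"
      using R by (intro B) auto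
    moreover have "trunc_norm (Suc M) R (fps_X * T (weighted w b)) \<le> R * D"
      unfolding trunc_norm_X_mult using R Suc by (intro mult_left_mono D) auto
    ultimately have rhs: "trunc_norm (Suc M) R (rhs b) \<le> B + 1"
      using trunc_norm_add[of R "Suc M"] R unfolding rhs_def by (smt (verit))
    show ?case
    proof (intro allI impI)
      fix k assume k: "k < d"
      have "norm (w k m * b m) \<le> \<bar>C\<bar> * norm (fps_nth (rhs b) m)" for m
      proof -
        have "p m * b m = - fps_nth (rhs b) m"
          using b unfolding solution_def by (simp add: eq_neg_iff_add_eq_0)
        then have pb: "norm (p m) * norm (b m) = norm (fps_nth (rhs b) m)"
          by (metis norm_minus_cancel norm_mult)
        have "norm (w k m) \<le> \<bar>C\<bar> * norm (p m)"
          using w_le[OF k, of m] by (smt (verit) mult_right_mono norm_ge_zero)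
        then have "norm (w k m) * norm (b m) \<le> \<bar>C\<bar> * norm (p m) * norm (b m)"
          by (intro mult_right_mono) auto
        then show ?thesis by (simp add: norm_mult mult.assoc pb)
      qed
      then have "trunc_norm (Suc M) R (weighted w b k) \<le>
          (\<Sum>i<Suc M. \<bar>C\<bar> * norm (fps_nth (rhs b) i) * R ^ i)"
        unfolding trunc_norm_def weighted_def fps_nth_Abs_fps
        using R by (intro sum_mono mult_right_mono) auto
      also have "\<dots> = \<bar>C\<bar> * trunc_norm (Suc M) R (rhs b)"
        unfolding trunc_norm_def sum_distrib_left by (simp only: mult.assoc)
      also have "\<dots> \<le> s"
        unfolding s_def using rhs by (intro mult_left_mono) auto
      finally show "trunc_norm (Suc M) R (weighted w b k) \<le> s" .
    qed
  qed
  with R(1) show ?thesis by blast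
qed

end

section \<open>The recursion for the coefficients\<close>

text \<open>
  The factor of \<open>A (m + 2)\<close> at order \<open>x\<^bsup>m+3\<^esup>\<close>, read off from \<open>red_poly_second_order\<close>.
\<close>

definition indicial :: "'a \<Rightarrow> nat \<Rightarrow> 'a::idom" where
  "indicial a m =
     a * (660 * of_nat (falling 2 (7 * m + 18)) - 22 * of_nat (falling 3 (7 * m + 18))
          - 1980 * of_nat (falling 1 (7 * m + 18)))
     - 88 * of_nat (falling 2 (7 * m + 18)) + 396 * of_nat (falling 1 (7 * m + 18))"

definition weight :: "nat \<Rightarrow> nat \<Rightarrow> 'a::idom" where
  "weight k m = of_nat (falling k (7 * m + 18))"

definition tail_op :: "(nat \<Rightarrow> 'a fps) \<Rightarrow> 'a::idom fps" where
  "tail_op g = tail_poly fps_X (g 0) (g 1) (g 2)"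

definition square_op :: "(nat \<Rightarrow> 'a fps) \<Rightarrow> 'a::idom fps" where
  "square_op h = 3 * h 2 ^ 2 - 2 * h 1 * h 3"

lemma falling_numerals:
  "falling 0 n = 1" "falling 1 n = n" "falling 2 n = n * (n - 1)"
  "falling 3 n = n * (n - 1) * (n - 2)"
  by (simp_all add: falling_def numeral_2_eq_2 numeral_3_eq_3)

text \<open>
  The known coefficients \<open>A 0 = 1\<close> and \<open>A 1\<close> are separated from the unknown ones. The weights of the
  latter are falling factors of \<open>7 m + 18 = 7 (m + 2) + 4\<close>.
\<close>

lemma euler_fps_split:
  fixes A :: "nat \<Rightarrow> 'a::idom"
  assumes "A 0 = 1"
  shows "euler_fps k A = fps_const (of_nat (falling k 4)) + fps_X *
    (fps_const (of_nat (falling k 11) * A 1) + fps_X * weighted weight (\<lambda>m. A (m + 2)) k)"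
proof (rule fps_ext)
  fix n :: nat
  consider "n = 0" | "n = 1" | m where "n = m + 2"
    using le_Suc_ex[of 2 n] by (force simp: add.commute)
  then show "fps_nth (euler_fps k A) n = fps_nth (fps_const (of_nat (falling k 4)) + fps_X *
    (fps_const (of_nat (falling k 11) * A 1) + fps_X * weighted weight (\<lambda>m. A (m + 2)) k)) n"
    by cases (auto simp: euler_fps_def weighted_def weight_def assms algebra_simps)
qed

lemma X_power_split_eq_0_iff:
  fixes S :: "'a::idom fps"
  shows "fps_X^2 * fps_const e + fps_X^3 * S = 0 \<longleftrightarrow> e = 0 \<and> S = 0"
proof -
  have "fps_X^2 * fps_const e + fps_X^3 * S = fps_X^2 * (fps_const e + fps_X * S)"
    by (simp add: algebra_simps eval_nat_numeral)
  moreover have "fps_const e + fps_X * S = 0 \<longleftrightarrow> e = 0 \<and> S = 0"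
  proof
    assume *: "fps_const e + fps_X * S = 0"
    from arg_cong[OF *, of "\<lambda>f. fps_nth f 0"] have "e = 0" by simp
    with * show "e = 0 \<and> S = 0" by simp
  qed auto
  ultimately show ?thesis by simp
qed

text \<open>
  The quadratic equation for \<open>A 1\<close> and the recursion for the other coefficients, obtained by
  comparing the coefficients of \<open>x\<^sup>2\<close> and of \<open>x\<^bsup>m+3\<^esup>\<close>.
\<close>

lemma red_poly_euler_eq_0_iff:
  fixes A :: "nat \<Rightarrow> 'a::field_char_0"
  assumes "A 0 = 1"
  defines "h \<equiv> weighted weight (\<lambda>m. A (m + 2))"
  shows "red_poly fps_X (euler_fps 0 A) (euler_fps 1 A) (euler_fps 2 A) (euler_fps 3 A) = 0 \<longleftrightarrow>
    (A 1 = 1/5 \<or> A 1 = 1/6) \<and>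
    (\<forall>m. indicial (A 1) m * A (m + 2) +
       fps_nth (tail_op (\<lambda>k. fps_const (of_nat (falling k 11) * A 1) + fps_X * h k)
         + fps_X * square_op h) m = 0)"
proof -
  define a where "a = fps_const (A 1)"
  define S where "S = a * (660 * h 2 - 22 * h 3 - 1980 * h 1) - 88 * h 2 + 396 * h 1
            + tail_poly fps_X (a + fps_X * h 0) (11 * a + fps_X * h 1) (110 * a + fps_X * h 2)
            + fps_X * (3 * h 2 ^ 2 - 2 * h 1 * h 3)"
  have u: "euler_fps 0 A = 1 + fps_X * (a + fps_X * h 0)"
    "euler_fps 1 A = 4 + fps_X * (11 * a + fps_X * h 1)"
    "euler_fps 2 A = 12 + fps_X * (110 * a + fps_X * h 2)"
    "euler_fps 3 A = 24 + fps_X * (990 * a + fps_X * h 3)"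
    unfolding euler_fps_split[of A, OF assms(1)] h_def[symmetric] falling_numerals a_def
    by (simp_all add: numeral_fps_const)
  have e: "484 * (30 * a^2 - 11 * a + 1) = fps_const (484 * (30 * (A 1)^2 - 11 * A 1 + 1))"
    by (simp add: a_def numeral_fps_const fps_const_power
        flip: fps_const_1_eq_1)
  have "red_poly fps_X (euler_fps 0 A) (euler_fps 1 A) (euler_fps 2 A) (euler_fps 3 A) = 0 \<longleftrightarrow>
      484 * (30 * (A 1)^2 - 11 * A 1 + 1) = 0 \<and> S = 0"
    unfolding u red_poly_second_order e X_power_split_eq_0_iff S_def ..
  moreover have "484 * (30 * (A 1)^2 - 11 * A 1 + 1) = 0 \<longleftrightarrow> A 1 = 1/5 \<or> A 1 = 1/6"
  proof -
    have "484 * (30 * (A 1)^2 - 11 * A 1 + 1) = 484 * ((5 * A 1 - 1) * (6 * A 1 - 1))"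
      by (simp add: algebra_simps power2_eq_square)
    also have "\<dots> = 0 \<longleftrightarrow> A 1 = 1/5 \<or> A 1 = 1/6"
      unfolding mult_eq_0_iff by (simp add: eq_divide_eq mult.commute)
    finally show ?thesis .
  qed
  moreover have "fps_nth S m = indicial (A 1) m * A (m + 2) +
       fps_nth (tail_op (\<lambda>k. fps_const (of_nat (falling k 11) * A 1) + fps_X * h k)
         + fps_X * square_op h) m" for m
  proof -
    have "fps_nth (a * (660 * h 2 - 22 * h 3 - 1980 * h 1) - 88 * h 2 + 396 * h 1) m =
        indicial (A 1) m * A (m + 2)"
      by (simp add: a_def h_def weighted_def weight_def indicial_def algebra_simps)
    moreover have "tail_op (\<lambda>k. fps_const (of_nat (falling k 11) * A 1) + fps_X * h k) =
        tail_poly fps_X (a + fps_X * h 0) (11 * a + fps_X * h 1) (110 * a + fps_X * h 2)"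
      unfolding tail_op_def falling_numerals a_def by (simp add: numeral_fps_const)
    ultimately show ?thesis
      unfolding S_def square_op_def by simp
  qed
  ultimately show ?thesis by (simp add: fps_eq_iff)
qed

lemma tame_tail_op: "tame 4 tail_op"
  unfolding tail_op_def[abs_def] tail_poly_def
  by (intro tame_add tame_diff tame_mult tame_power tame_numeral tame_X tame_proj) simp_all

lemma tame_square_op: "tame 4 square_op"
  unfolding square_op_def[abs_def]
  by (intro tame_diff tame_mult tame_power tame_numeral tame_proj) simp_all

text \<open>
  At the two roots the cubic factors into linear terms over the rationals; the factors are \<open>n\<close>, \<open>n - 1\<close>, \<open>n - 12\<close>
  and \<open>n\<close>, \<open>n - 10\<close>, \<open>n + 1\<close> for \<open>n = 7 m + 18\<close>.
\<close>

lemma indicial_roots: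
  "indicial (1/5 :: 'a::field_char_0) m = - (22/5) * of_nat ((7*m+18) * (7*m+17) * (7*m+6))"
  "indicial (1/6 :: 'a::field_char_0) m = - (11/3) * of_nat ((7*m+18) * (7*m+8) * (7*m+19))"
  unfolding indicial_def falling_numerals by (simp_all add: field_simps)

text \<open>
  All weights are at most \<open>n (n - 1) (n - 2)\<close>, which is compared factor by factor with the cubics above;
  \<open>n - 2 \<le> 3 (n - 12)\<close> and \<open>(n - 1) (n - 2) \<le> 3 (n - 10) (n + 1)\<close> hold for \<open>n \<ge> 18\<close>.
\<close>

lemma indicial_dominates_weight:
  fixes a :: "'a::real_normed_field"
  assumes "a = 1/5 \<or> a = 1/6" "k < 4"
  shows "norm (weight k m :: 'a) \<le> 3 * norm (indicial a m)"
proof -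
  have w: "norm (weight k m :: 'a) \<le> real ((7*m+18) * (7*m+17) * (7*m+16))"
  proof -
    have "k = 0 \<or> k = 1 \<or> k = 2 \<or> k = 3" using assms(2) by auto
    then have "falling k (7*m+18) \<le> (7*m+18) * (7*m+17) * (7*m+16)"
      by (auto simp: falling_numerals algebra_simps simp del: One_nat_def)
    then show ?thesis unfolding weight_def norm_of_nat of_nat_le_iff .
  qed
  have n: "norm (indicial (1/5 :: 'a) m) = 22/5 * real ((7*m+18) * (7*m+17) * (7*m+6))"
    "norm (indicial (1/6 :: 'a) m) = 11/3 * real ((7*m+18) * (7*m+8) * (7*m+19))"
    unfolding indicial_roots norm_mult norm_minus_cancel norm_of_nat
    by (simp_all add: norm_divide del: of_nat_mult of_nat_add)
  have "real ((7*m+18) * (7*m+17) * (7*m+16)) \<le> real (3 * ((7*m+18) * (7*m+17) * (7*m+6)))"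
    unfolding of_nat_le_iff by (simp add: algebra_simps)
  moreover have "real ((7*m+18) * (7*m+17) * (7*m+16)) \<le> real (3 * ((7*m+18) * (7*m+8) * (7*m+19)))"
    unfolding of_nat_le_iff by (simp add: algebra_simps)
  moreover have "(a = 1/5 \<and> norm (indicial a m) = 22/5 * real ((7*m+18) * (7*m+17) * (7*m+6))) \<or>
      (a = 1/6 \<and> norm (indicial a m) = 11/3 * real ((7*m+18) * (7*m+8) * (7*m+19)))"
    using assms(1) n by blast
  ultimately show ?thesis
    using w by (auto simp add: of_nat_mult[of 3] simp del: of_nat_mult of_nat_add)
qed

lemma indicial_nonzero:
  fixes a :: "'a::field_char_0"
  assumes "a = 1/5 \<or> a = 1/6"
  shows "indicial a m \<noteq> 0"
  using assms
proof
  assume "a = 1/5"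
  then show ?thesis
    by (simp only: indicial_roots) (simp del: of_nat_mult of_nat_add)
next
  assume "a = 1/6"
  then show ?thesis
    by (simp only: indicial_roots) (simp del: of_nat_mult of_nat_add)
qed

lemma causal_recursion_coeffs:
  fixes a :: "'a::real_normed_field"
  assumes "a = 1/5 \<or> a = 1/6"
  shows "causal_recursion 4 tail_op square_op (indicial a) weight 3"
  by unfold_locales
    (use assms in \<open>auto simp: tame_tail_op tame_square_op indicial_nonzero indicial_dominates_weight\<close>)

section \<open>Admissible coefficient sequences\<close>

definition admissible :: "(nat \<Rightarrow> 'a::field_char_0) \<Rightarrow> bool" where
  "admissible A \<longleftrightarrow> A 0 = 1 \<and>
     red_poly fps_X (euler_fps 0 A) (euler_fps 1 A) (euler_fps 2 A) (euler_fps 3 A) = 0"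

lemma admissible_iff:
  fixes A :: "nat \<Rightarrow> 'a::real_normed_field"
  shows "admissible A \<longleftrightarrow> A 0 = 1 \<and> (A 1 = 1/5 \<or> A 1 = 1/6) \<and>
    causal_recursion.solution tail_op square_op (indicial (A 1))
      (\<lambda>k. of_nat (falling k 11) * A 1) weight (\<lambda>m. A (m + 2))"
proof (cases "A 0 = 1 \<and> (A 1 = 1/5 \<or> A 1 = 1/6)")
  case True
  then interpret causal_recursion 4 tail_op square_op "indicial (A 1)"
      "\<lambda>k. of_nat (falling k 11) * A 1" weight 3
    by (intro causal_recursion_coeffs) auto
  have "red_poly fps_X (euler_fps 0 A) (euler_fps 1 A) (euler_fps 2 A) (euler_fps 3 A) = 0 \<longleftrightarrow>
      (A 1 = 1/5 \<or> A 1 = 1/6) \<and> solution (\<lambda>m. A (m + 2))"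
    unfolding solution_def rhs_def by (rule red_poly_euler_eq_0_iff) (use True in blast)
  then show ?thesis
    using True unfolding admissible_def by blast
next
  case False
  then show ?thesis
    using red_poly_euler_eq_0_iff[of A] by (auto simp: admissible_def)
qed

lemma admissible_unique:
  fixes A A' :: "nat \<Rightarrow> 'a::real_normed_field"
  assumes "admissible A" "admissible A'" "A 1 = A' 1"
  shows "A = A'"
proof -
  from assms(1) have root: "A 1 = 1/5 \<or> A 1 = 1/6" by (simp add: admissible_iff)
  interpret causal_recursion 4 tail_op square_op "indicial (A 1)"
      "\<lambda>k. of_nat (falling k 11) * A 1" weight 3
    by (rule causal_recursion_coeffs[OF root])
  have tails: "(\<lambda>m. A (m + 2)) = (\<lambda>m. A' (m + 2))"
    using assms by (intro solution_unique) (simp_all add: admissible_iff)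
  show ?thesis
  proof
    fix n :: nat
    consider "n = 0" | "n = 1" | m where "n = m + 2"
      using le_Suc_ex[of 2 n] by (force simp: add.commute)
    then show "A n = A' n"
      by cases (use assms tails in \<open>auto simp: admissible_iff dest: fun_cong\<close>)
  qed
qed

lemma admissible_exists:
  fixes a :: "'a::real_normed_field"
  assumes "a = 1/5 \<or> a = 1/6"
  shows "\<exists>A. admissible A \<and> A 1 = a \<and> (\<exists>R>0. summable (\<lambda>m. norm (A m) * R ^ m))"
proof -
  interpret causal_recursion 4 tail_op square_op "indicial a"
      "\<lambda>k. of_nat (falling k 11) * a" weight 3
    by (rule causal_recursion_coeffs[OF assms])
  obtain b where b: "solution b" using solution_exists by blast
  define A where "A n = (case n of 0 \<Rightarrow> 1 | Suc 0 \<Rightarrow> a | Suc (Suc m) \<Rightarrow> b m)" for n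
  have A: "A 0 = 1" "A 1 = a" "(\<lambda>m. A (m + 2)) = b"
    by (simp_all add: A_def)
  obtain R s where R: "R > 0" and s: "\<And>M k. k < 4 \<Longrightarrow> trunc_norm M R (weighted weight b k) \<le> s"
    using solution_bounded[OF b] by blast
  have "(\<Sum>i<M. norm (b i) * R ^ i) \<le> s" for M
    using s[of 0 M] by (simp add: trunc_norm_def weighted_def weight_def falling_numerals)
  then have "summable (\<lambda>m. norm (b m) * R ^ m)"
    using R by (intro summableI_nonneg_bounded) auto
  then have "summable (\<lambda>m. R^2 * (norm (b m) * R ^ m))"
    by (rule summable_mult)
  also have "(\<lambda>m. R^2 * (norm (b m) * R ^ m)) = (\<lambda>m. norm (A (m + 2)) * R ^ (m + 2))"
    unfolding A(3)[symmetric] by (simp only: power_add mult_ac)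
  finally have "summable (\<lambda>m. norm (A (m + 2)) * R ^ (m + 2))" .
  then have "summable (\<lambda>m. norm (A m) * R ^ m)"
    by (subst (asm) summable_iff_shift)
  moreover have "admissible A"
    unfolding admissible_iff A using assms b by simp
  ultimately show ?thesis using A R by blast
qed

section \<open>Counting the germs\<close>

definition graded_fun :: "real \<Rightarrow> (nat \<Rightarrow> 'a) \<Rightarrow> 'a \<Rightarrow> 'a::{real_normed_field, banach}" where
  "graded_fun rho A t = (\<Sum>m. A m * of_real rho ^ (2 * m + 1) * (t / 2) ^ (7 * m + 4))"

lemma graded_fun_has_fps_expansion:
  fixes A :: "nat \<Rightarrow> 'a::{real_normed_field, banach}"
  assumes R: "R > 0" "summable (\<lambda>m. norm (A m) * R ^ m)"
  shows "graded_fun rho A has_fps_expansion graded_fps (of_real (rho / 16)) A"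
proof (rule has_fps_expansionI)
  have "((\<lambda>t::'a. \<bar>rho\<bar>^2 * norm (t / 2) ^ 7) \<longlongrightarrow> \<bar>rho\<bar>^2 * norm (0 / 2 :: 'a) ^ 7) (nhds 0)"
    by (intro tendsto_intros filterlim_ident) simp
  then have "\<forall>\<^sub>F t::'a in nhds 0. \<bar>rho\<bar>^2 * norm (t / 2) ^ 7 < R"
    by (rule order_tendstoD(2)) (use R in simp)
  then show "\<forall>\<^sub>F t in nhds 0. (\<lambda>n. fps_nth (graded_fps (of_real (rho / 16)) A) n * t ^ n) sums
      graded_fun rho A t"
  proof (rule eventually_mono)
    fix t :: 'a
    let ?q = "\<bar>rho\<bar>^2 * norm (t / 2) ^ 7"
    assume q: "?q < R"
    have "summable (\<lambda>m. A m * of_real rho ^ (2 * m + 1) * (t / 2) ^ (7 * m + 4))"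
    proof (rule summable_comparison_test')
      show "summable (\<lambda>m. (\<bar>rho\<bar> * norm (t / 2) ^ 4) * (norm (A m) * R ^ m))"
        by (intro summable_mult R)
      fix m :: nat
      have "norm (A m * of_real rho ^ (2 * m + 1) * (t / 2) ^ (7 * m + 4)) =
          (\<bar>rho\<bar> * norm (t / 2) ^ 4) * (norm (A m) * ?q ^ m)"
        unfolding norm_mult norm_power norm_of_real power_add power_mult power_one_right
        by (simp only: power_mult_distrib mult_ac)
      also have "\<dots> \<le> (\<bar>rho\<bar> * norm (t / 2) ^ 4) * (norm (A m) * R ^ m)"
        using q by (intro mult_left_mono power_mono) auto
      finally show "norm (A m * of_real rho ^ (2 * m + 1) * (t / 2) ^ (7 * m + 4)) \<le>
          (\<bar>rho\<bar> * norm (t / 2) ^ 4) * (norm (A m) * R ^ m)" .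
    qed
    then show "(\<lambda>n. fps_nth (graded_fps (of_real (rho / 16)) A) n * t ^ n) sums graded_fun rho A t"
      unfolding graded_series_sums_iff graded_fun_def by (rule summable_sums)
  qed
qed

definition solution_germ :: "real \<Rightarrow> ('a \<Rightarrow> 'a::{real_normed_field, banach}) \<Rightarrow> bool" where
  "solution_germ rho F \<longleftrightarrow>
      analytic_at_0 F \<and>
      F 0 = 0 \<and> deriv F 0 = 0 \<and> (deriv ^^ 2) F 0 = 0 \<and> (deriv ^^ 3) F 0 = 0 \<and>
      taylor_coeff 4 F = of_real (rho / 16) \<and>
      graded_analytic rho F \<and>
      compat_condition rho F"

lemma solution_germ_iff:
  fixes F :: "'a \<Rightarrow> 'a::{real_normed_field, banach}"
  assumes "rho \<noteq> 0"
  shows "solution_germ rho F \<longleftrightarrow>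
    (\<exists>A. admissible A \<and> F has_fps_expansion graded_fps (of_real (rho / 16)) A)"
proof -
  have nz: "of_real (rho / 16) \<noteq> (0::'a)" using assms by simp
  have coeffs: "F 0 = 0 \<and> deriv F 0 = 0 \<and> (deriv ^^ 2) F 0 = 0 \<and> (deriv ^^ 3) F 0 = 0"
      "taylor_coeff 4 F = of_real (rho / 16) \<longleftrightarrow> A 0 = 1"
    if F: "F has_fps_expansion graded_fps (of_real (rho / 16)) A" for A
  proof -
    have d: "(deriv ^^ n) F 0 = fact n * fps_nth (graded_fps (of_real (rho / 16)) A) n" for n
      unfolding fps_nth_eq_higher_deriv[OF F] by simp
    show "F 0 = 0 \<and> deriv F 0 = 0 \<and> (deriv ^^ 2) F 0 = 0 \<and> (deriv ^^ 3) F 0 = 0"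
      using d[of 0] d[of 1] d[of 2] d[of 3] by (simp add: fps_nth_graded_fps)
    show "taylor_coeff 4 F = of_real (rho / 16) \<longleftrightarrow> A 0 = 1"
      using nz unfolding taylor_coeff_def d by (simp add: fps_nth_graded_fps)
  qed
  show ?thesis
  proof
    assume F: "solution_germ rho F"
    then obtain A where A: "F has_fps_expansion graded_fps (of_real (rho / 16)) A"
      unfolding solution_germ_def graded_analytic_iff by blast
    with F have "admissible A"
      using coeffs(2)[OF A] compat_condition_graded_iff[OF assms A]
      by (simp add: solution_germ_def admissible_def)
    with A show "\<exists>A. admissible A \<and> F has_fps_expansion graded_fps (of_real (rho / 16)) A"
      by blast
  next
    assume "\<exists>A. admissible A \<and> F has_fps_expansion graded_fps (of_real (rho / 16)) A"
    then obtain A where A: "admissible A" "F has_fps_expansion graded_fps (of_real (rho / 16)) A"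
      by blast
    then show "solution_germ rho F"
      using coeffs[OF A(2)] compat_condition_graded_iff[OF assms A(2)]
      unfolding solution_germ_def graded_analytic_iff analytic_at_0_def admissible_def by blast
  qed
qed

text \<open>
  Germs of analytic functions may be counted by their Taylor series.
\<close>

lemma germ_rel_iff_same_expansion:
  fixes F G :: "'a \<Rightarrow> 'a::{real_normed_field, banach}"
  assumes "F has_fps_expansion P" "G has_fps_expansion Q"
  shows "(F, G) \<in> germ_rel \<longleftrightarrow> P = Q"
proof
  assume "(F, G) \<in> germ_rel"
  then show "P = Q"
    using has_fps_expansion_transfer[OF assms(1), of G] has_fps_expansion_unique[OF _ assms(2)]
    by (simp add: germ_rel_def)
next
  assume PQ: "P = Q"
  have "\<forall>\<^sub>F t in nhds 0. eval_fps P t = F t" "\<forall>\<^sub>F t in nhds 0. eval_fps P t = G t"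
    using assms unfolding PQ has_fps_expansion_def by blast+
  then show "(F, G) \<in> germ_rel"
    unfolding germ_rel_def by (auto elim: eventually_elim2)
qed

lemma equiv_germ_rel: "equiv UNIV germ_rel"
  unfolding germ_rel_def
  by (intro equivI) (auto simp: refl_on_def sym_def trans_def elim: eventually_mono eventually_elim2)

theorem corollary9p1:
  fixes rho :: real
  assumes "rho \<noteq> 0"
  shows "card ({F :: 'a \<Rightarrow> 'a::{real_normed_field, banach}.
      analytic_at_0 F \<and>
      F 0 = 0 \<and> deriv F 0 = 0 \<and> (deriv ^^ 2) F 0 = 0 \<and> (deriv ^^ 3) F 0 = 0 \<and>
      taylor_coeff 4 F = of_real (rho / 16) \<and>
      graded_analytic rho F \<and>
      compat_condition rho F} // germ_rel) = 2"
proof -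
  let ?P = "graded_fps (of_real (rho / 16) :: 'a)"
  let ?S = "{F :: 'a \<Rightarrow> 'a. solution_germ rho F}"
  obtain A1 where A1: "admissible A1" "A1 1 = (1/5 :: 'a)" "graded_fun rho A1 has_fps_expansion ?P A1"
    using admissible_exists[of "1/5 :: 'a"] graded_fun_has_fps_expansion by blast
  obtain A2 where A2: "admissible A2" "A2 1 = (1/6 :: 'a)" "graded_fun rho A2 has_fps_expansion ?P A2"
    using admissible_exists[of "1/6 :: 'a"] graded_fun_has_fps_expansion by blast
  define F1 F2 where "F1 = graded_fun rho A1" and "F2 = graded_fun rho A2"
  have mem: "F1 \<in> ?S" "F2 \<in> ?S"
    using A1 A2 by (auto simp: solution_germ_iff[OF assms] F1_def F2_def)
  have "A1 1 \<noteq> A2 1"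
    unfolding A1(2) A2(2) by simp
  \<comment> \<open>The coefficient \<open>A 1\<close> belongs to the power \<open>t\<^bsup>11\<^esup>\<close>.\<close>
  then have "fps_nth (?P A1) 11 \<noteq> fps_nth (?P A2) 11"
    using assms by (simp add: fps_nth_graded_fps)
  then have "?P A1 \<noteq> ?P A2" by metis
  then have "(F1, F2) \<notin> germ_rel"
    unfolding F1_def F2_def by (simp add: germ_rel_iff_same_expansion[OF A1(3) A2(3)])
  then have distinct: "germ_rel `` {F1} \<noteq> germ_rel `` {F2}"
    by (simp add: eq_equiv_class_iff[OF equiv_germ_rel])
  have classes: "germ_rel `` {F} = germ_rel `` {F1} \<or> germ_rel `` {F} = germ_rel `` {F2}"
    if F: "F \<in> ?S" for F
  proof -
    obtain A where A: "admissible A" "F has_fps_expansion ?P A"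
      using F unfolding mem_Collect_eq solution_germ_iff[OF assms] by blast
    from A(1) have "A 1 = A1 1 \<or> A 1 = A2 1"
      unfolding A1(2) A2(2) admissible_iff by blast
    then have "A = A1 \<or> A = A2"
      using admissible_unique A(1) A1(1) A2(1) by blast
    then have "(F, F1) \<in> germ_rel \<or> (F, F2) \<in> germ_rel"
      unfolding F1_def F2_def
      by (auto simp: germ_rel_iff_same_expansion[OF A(2) A1(3)] germ_rel_iff_same_expansion[OF A(2) A2(3)])
    then show ?thesis
      by (simp add: eq_equiv_class_iff[OF equiv_germ_rel])
  qed
  have "?S // germ_rel = {germ_rel `` {F1}, germ_rel `` {F2}}"
    unfolding quotient_def using mem classes by blast
  then have "card (?S // germ_rel) = 2"
    using distinct by simp
  then show ?thesis by (simp only: solution_germ_def)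
qed

end
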